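(* For every integer $k\ge 2$ there exists a constant $C_k$, depending only on $k$, such that $\mathrm{ER}^{(k)}(n)\le t_{k-1}(C_k n^{6k})$ holds for every positive integer $n$.
   Context: For a natural number $N$ let $[N]=\{1,\dots,N\}$, and for a set $X$ let $X^{(k)}$ be the set of all $k$-element subsets of $X$. The tower functions are defined by $t_0(x)=x$ and $t_{i+1}(x)=2^{t_i(x)}$. For $I\subseteq[k]$ and two $k$-element sets of positive integers $x=\{x_1<\dots<x_k\}$ and $y=\{y_1<\dots<y_k\}$ write $x\equiv_I y$ if $x_i=y_i$ for all $i\in I$. $\mathrm{ER}^{(k)}(n)$ (the Erdős–Rado number) is the least integer such that for every $N\ge \mathrm{ER}^{(k)}(n)$ and every equivalence relation $\equiv$ on $[N]^{(k)}$ there exist an $n$-element set $X\subseteq[N]$ and a set $I\subseteq[k]$ such that $\equiv$ and $\equiv_I$ agree on $X^{(k)}$. (Its existence is the canonical Ramsey theorem of Erdős and Rado.) *)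

theory Defs
  imports Complex_Main "HOL-Library.Ramsey"
begin

primrec tower :: "nat \<Rightarrow> real \<Rightarrow> real" where
  "tower 0 x = x"
| "tower (Suc i) x = 2 powr (tower i x)"

(* nth_least x i is x_i for x = {x_1 < ... < x_k}; positions are 1-based *)
definition nth_least :: "nat set \<Rightarrow> nat \<Rightarrow> nat" where
  "nth_least x i = sorted_list_of_set x ! (i - 1)"

definition canonical_eq :: "nat set \<Rightarrow> nat set \<Rightarrow> nat set \<Rightarrow> bool" where
  "canonical_eq I x y \<longleftrightarrow> (\<forall>i\<in>I. nth_least x i = nth_least y i)"

(* Every equivalence relation on the k-subsets of {1..N} is canonical on the
   k-subsets of some n-element set X. *)
definition canonical_ramsey :: "nat \<Rightarrow> nat \<Rightarrow> nat \<Rightarrow> bool" where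
  "canonical_ramsey k n N \<longleftrightarrow>
     (\<forall>R. equiv (nsets {1..N} k) R \<longrightarrow>
        (\<exists>X I. X \<subseteq> {1..N} \<and> card X = n \<and> I \<subseteq> {1..k} \<and>
           (\<forall>x\<in>nsets X k. \<forall>y\<in>nsets X k. (x, y) \<in> R \<longleftrightarrow> canonical_eq I x y)))"

(* The minimum exists by the Erdos-Rado canonical Ramsey theorem. For n > 0 the value
   M = 0 is ruled out (N = 0 fails), so minimising over nat or over int is the same. *)
definition ER :: "nat \<Rightarrow> nat \<Rightarrow> nat" where
  "ER k n = (LEAST M. \<forall>N\<ge>M. canonical_ramsey k n N)"

end

theory Submission
  imports Defs
begin

text \<open>
  Induction on the uniformity, stepping down as in Erdos and Rado. From a colouring \<open>c\<close> of
  \<open>i\<close>-sets one passes, at the cost of one exponential, to a set \<open>A\<close> and a point \<open>\<omega>\<close> above it such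
  that for \<open>(i-1)\<close>-sets \<open>p, q\<close> and \<open>i\<close>-sets \<open>w\<close> the truth of \<open>c(p z) = c(q z)\<close> and of
  \<open>c(p z) = c(w)\<close> does not depend on \<open>z\<close> above them. Then \<open>p \<mapsto> c(p \<omega>)\<close> is a
  colouring of \<open>(i-1)\<close>-sets, and for every \<open>p\<close> the map \<open>z \<mapsto> c(p z)\<close> is injective up to
  some threshold and constant from there on.

  The point is to decide on which side of the threshold one is without losing another exponential.
  To this end the relations "the threshold has been passed" are carried along in the induction:
  they are relations on \<open>(i+1)\<close>-sets that are monotone in the last element. If such a relation is
  \<open>E(y, b, z)\<close>, then either some \<open>b\<close> in the lower half of the reservoir satisfies it for all
  \<open>z\<close> in the upper half, or a large part of the lower half never satisfies it. So
  \<open>E\<close> becomes independent of \<open>z\<close> and monotone (decreasing) in \<open>b\<close>, hence it steps down with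
  its monotonicity intact. At uniformity 1 there are \<open>k - 1\<close> monotone graphs and one colouring of
  points, for which a set of size \<open>O(n^(2k))\<close> suffices; the innermost exponential costs a
  third power, which gives \<open>n^(6k)\<close>.
\<close>

section \<open>Chains and fibres\<close>

lemma split_initial:
  fixes S :: "nat set"
  assumes "finite S" "u \<le> card S"
  obtains W where "W \<subseteq> S" "card W = u" "\<And>a b. a \<in> W \<Longrightarrow> b \<in> S - W \<Longrightarrow> a < b"
proof -
  have "\<exists>W\<subseteq>S. card W = u \<and> (\<forall>a\<in>W. \<forall>b\<in>S - W. a < b)"
    using assms(2)
  proof (induction u)
    case 0
    show ?case by (intro exI[of _ "{}"]) auto
  next
    case (Suc u)
    then obtain W where W: "W \<subseteq> S" "card W = u" "\<forall>a\<in>W. \<forall>b\<in>S - W. a < b" by auto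
    have fin: "finite (S - W)" "finite W"
      using assms(1) W(1) finite_subset by auto
    have ne: "S - W \<noteq> {}"
      using Suc.prems W(1,2) assms(1) by (metis Diff_eq_empty_iff card_mono fin(2) not_less_eq_eq)
    define v where "v = Min (S - W)"
    have v: "v \<in> S - W" using Min_in[OF fin(1) ne] by (simp add: v_def)
    have "v < b" if "b \<in> S - insert v W" for b
    proof -
      have "v \<le> b" unfolding v_def using that by (intro Min_le fin) auto
      with that show ?thesis by auto
    qed
    with v W fin show ?case by (intro exI[of _ "insert v W"]) auto
  qed
  with that show ?thesis by blast
qed

lemma large_fibre:
  assumes "finite S" "finite T" "g ` S \<subseteq> T" "card T \<le> q" "q * t \<le> card S" "q > 0"
  obtains y where "t \<le> card {s \<in> S. g s = y}"
proof (rule ccontr)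
  assume "\<not> thesis"
  with that have less: "card {s \<in> S. g s = y} < t" for y by (meson not_le)
  hence "t > 0" by (metis gr_zeroI not_less0)
  have "card S = (\<Sum>y\<in>T. card {s \<in> S. g s = y})"
    using sum.group[OF assms(1,2,3), of "\<lambda>_. 1::nat"] by simp
  also have "\<dots> \<le> (\<Sum>y\<in>T. t - 1)"
  proof (rule sum_mono)
    show "card {s \<in> S. g s = y} \<le> t - 1" for y using less[of y] by linarith
  qed
  also have "\<dots> \<le> q * (t - 1)"
    using assms(4) by simp
  also have "\<dots> < q * t"
    using \<open>t > 0\<close> assms(6) by simp
  finally show False using assms(5) by simp
qed

lemma card_nsets_le:
  assumes "finite A" "card A \<le> m"
  shows "card (nsets A k) \<le> m ^ k"
proof -
  have "nsets A k = {B. B \<subseteq> A \<and> card B = k}"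
    using assms(1) by (auto simp: nsets_def intro: finite_subset)
  hence "card (nsets A k) = card A choose k"
    using n_subsets[OF assms(1)] by simp
  also have "\<dots> \<le> card A ^ k"
    by (cases "k \<le> card A") (auto intro: binomial_le_pow simp: binomial_eq_0)
  also have "\<dots> \<le> m ^ k"
    using assms(2) by (rule power_mono) simp
  finally show ?thesis .
qed

section \<open>Ramsey statements for monotone relations, with polynomial bounds\<close>

text \<open>Cut off the first \<open>w\<close> points. Either this block has no related pair and is
  the second alternative, or it contains a related pair \<open>a < b\<close>. Then monotonicity
  relates \<open>a\<close> to every point beyond the block, so \<open>a\<close> can be put in front
  of a chain found there. The bound is thus a product, as in the Erdos-Szekeres theorem.\<close>

lemma chain_or_antichain:
  fixes R :: "nat \<Rightarrow> nat \<Rightarrow> bool"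
  assumes "finite S" "u * w \<le> card S"
    and "\<And>a b d. a \<in> S \<Longrightarrow> b \<in> S \<Longrightarrow> d \<in> S \<Longrightarrow> a < b \<Longrightarrow> b < d \<Longrightarrow> R a b \<Longrightarrow> R a d"
  shows "(\<exists>X\<subseteq>S. card X = u \<and> (\<forall>a\<in>X. \<forall>b\<in>X. a < b \<longrightarrow> R a b)) \<or>
         (\<exists>X\<subseteq>S. card X = w \<and> (\<forall>a\<in>X. \<forall>b\<in>X. a < b \<longrightarrow> \<not> R a b))"
  using assms
proof (induction u arbitrary: S)
  case 0
  show ?case by (intro disjI1 exI[of _ "{}"]) auto
next
  case (Suc u)
  have "w \<le> card S" using Suc.prems(2) by simp
  then obtain W where W: "W \<subseteq> S" "card W = w" "\<And>a b. a \<in> W \<Longrightarrow> b \<in> S - W \<Longrightarrow> a < b"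
    using split_initial[OF Suc.prems(1)] by metis
  show ?case
  proof (cases "\<forall>a\<in>W. \<forall>b\<in>W. a < b \<longrightarrow> \<not> R a b")
    case True
    with W show ?thesis by blast
  next
    case False
    then obtain a b where ab: "a \<in> W" "b \<in> W" "a < b" "R a b" by blast
    have "finite (S - W)" using Suc.prems(1) by simp
    moreover have "u * w \<le> card (S - W)"
      using Suc.prems(1,2) W by (simp add: card_Diff_subset finite_subset)
    ultimately consider
      X where "X \<subseteq> S - W" "card X = u" "\<forall>a\<in>X. \<forall>b\<in>X. a < b \<longrightarrow> R a b"
      | X where "X \<subseteq> S - W" "card X = w" "\<forall>a\<in>X. \<forall>b\<in>X. a < b \<longrightarrow> \<not> R a b"
      using Suc.IH[of "S - W"] Suc.prems(3) by blast
    then show ?thesis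
    proof cases
      case 1
      have above: "a < d \<and> R a d" if "d \<in> X" for d
      proof -
        have "b < d" using W(3) ab that 1(1) by blast
        thus ?thesis using Suc.prems(3)[of a b d] ab W(1) 1(1) that by auto
      qed
      have "finite X" using 1(1) Suc.prems(1) by (meson finite_Diff finite_subset)
      moreover have "a \<notin> X" using above by blast
      ultimately have "card (insert a X) = Suc u" using 1(2) by simp
      moreover have "\<forall>x\<in>insert a X. \<forall>y\<in>insert a X. x < y \<longrightarrow> R x y"
        using 1(3) above by (metis insert_iff less_asym less_irrefl)
      ultimately show ?thesis
        using 1(1) ab W(1) by (intro disjI1 exI[of _ "insert a X"]) auto
    next
      case 2
      then show ?thesis by blast
    qed
  qed
qed

text \<open>Peels off the top value: \<open>Suc d \<le> h a b\<close> is monotone in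
  \<open>b\<close>, so there are either \<open>u\<close> points on which \<open>h\<close> is
  constantly \<open>Suc d\<close>, or \<open>u ^ Suc d\<close> points on which \<open>h\<close> is
  at most \<open>d\<close>.\<close>

lemma const_level_on_pairs:
  fixes h :: "nat \<Rightarrow> nat \<Rightarrow> nat"
  assumes "finite S" "u ^ Suc d \<le> card S"
    and "\<And>a b e. a \<in> S \<Longrightarrow> b \<in> S \<Longrightarrow> e \<in> S \<Longrightarrow> a < b \<Longrightarrow> b < e \<Longrightarrow> h a b \<le> h a e"
    and "\<And>a b. a \<in> S \<Longrightarrow> b \<in> S \<Longrightarrow> a < b \<Longrightarrow> h a b \<le> d"
  shows "\<exists>X v. X \<subseteq> S \<and> card X = u \<and> (\<forall>a\<in>X. \<forall>b\<in>X. a < b \<longrightarrow> h a b = v)"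
  using assms
proof (induction d arbitrary: S)
  case 0
  then obtain W where "W \<subseteq> S" "card W = u"
    by (metis obtain_subset_with_card_n power_Suc0_right)
  with 0 show ?case by (intro exI[of _ W] exI[of _ 0]) (auto dest: subsetD)
next
  case (Suc d)
  have mono: "Suc d \<le> h a e"
    if "a \<in> S" "b \<in> S" "e \<in> S" "a < b" "b < e" "Suc d \<le> h a b" for a b e
    using Suc.prems(3) that le_trans by blast
  have "u * u ^ Suc d \<le> card S" using Suc.prems(2) by simp
  from chain_or_antichain[OF Suc.prems(1) this, of "\<lambda>a b. Suc d \<le> h a b"] mono
  consider X where "X \<subseteq> S" "card X = u" "\<forall>a\<in>X. \<forall>b\<in>X. a < b \<longrightarrow> Suc d \<le> h a b"
    | X where "X \<subseteq> S" "card X = u ^ Suc d" "\<forall>a\<in>X. \<forall>b\<in>X. a < b \<longrightarrow> \<not> Suc d \<le> h a b"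
    by blast
  then show ?case
  proof cases
    case 1
    then have "h a b = Suc d" if "a \<in> X" "b \<in> X" "a < b" for a b
      using Suc.prems(4)[of a b] that by (simp add: le_antisym subset_iff)
    with 1 show ?thesis by blast
  next
    case 2
    have "\<exists>X' v. X' \<subseteq> X \<and> card X' = u \<and> (\<forall>a\<in>X'. \<forall>b\<in>X'. a < b \<longrightarrow> h a b = v)"
    proof (rule Suc.IH)
      show "finite X" using 2(1) Suc.prems(1) finite_subset by blast
      show "u ^ Suc d \<le> card X" using 2 by simp
      show "\<And>a b e. a \<in> X \<Longrightarrow> b \<in> X \<Longrightarrow> e \<in> X \<Longrightarrow> a < b \<Longrightarrow> b < e \<Longrightarrow> h a b \<le> h a e"
        using Suc.prems(3) 2(1) by blast
      show "\<And>a b. a \<in> X \<Longrightarrow> b \<in> X \<Longrightarrow> a < b \<Longrightarrow> h a b \<le> d"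
        using 2(3) by (meson not_less_eq_eq)
    qed
    then show ?thesis using 2(1) by (blast intro: subset_trans)
  qed
qed

text \<open>The set \<open>H a b\<close> of relations holding at a pair grows with \<open>b\<close>,
  so once its cardinality is constant it depends on \<open>a\<close> only, and a pigeonhole over
  \<open>2 ^ r\<close> sets finishes. Going through the cardinality keeps the exponent at
  \<open>Suc r\<close>; treating the relations one after the other would square the size
  \<open>r\<close> times.\<close>

lemma const_relations_on_pairs:
  fixes G :: "nat \<Rightarrow> nat \<Rightarrow> nat \<Rightarrow> bool"
  assumes "finite S" "(2 ^ r * u) ^ Suc r \<le> card S"
    and mono: "\<And>l a b d. l < r \<Longrightarrow> a \<in> S \<Longrightarrow> b \<in> S \<Longrightarrow> d \<in> S \<Longrightarrow> a < b \<Longrightarrow> b < d \<Longrightarrow> G l a b \<Longrightarrow> G l a d"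
  shows "\<exists>X L. X \<subseteq> S \<and> card X = u \<and> (\<forall>l<r. \<forall>a\<in>X. \<forall>b\<in>X. a < b \<longrightarrow> G l a b = (l \<in> L))"
proof -
  define H where "H a b = {l. l < r \<and> G l a b}" for a b
  have finH: "finite (H a b)" for a b by (simp add: H_def)
  have mono': "H a b \<subseteq> H a d" if "a \<in> S" "b \<in> S" "d \<in> S" "a < b" "b < d" for a b d
    using mono that by (auto simp: H_def)
  have le: "card (H a b) \<le> r" for a b
    using card_mono[of "{..<r}" "H a b"] by (auto simp: H_def)
  have lvl: "card (H a b) \<le> card (H a d)" if "a \<in> S" "b \<in> S" "d \<in> S" "a < b" "b < d" for a b d
    using mono'[OF that] finH by (rule card_mono[rotated])
  have "\<exists>X v. X \<subseteq> S \<and> card X = 2 ^ r * u \<and> (\<forall>a\<in>X. \<forall>b\<in>X. a < b \<longrightarrow> card (H a b) = v)"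
    by (rule const_level_on_pairs[OF assms(1,2)]) (use lvl le in auto)
  then obtain X v where X: "X \<subseteq> S" "card X = 2 ^ r * u"
    and v: "\<forall>a\<in>X. \<forall>b\<in>X. a < b \<longrightarrow> card (H a b) = v"
    by (elim exE conjE)
  have finX: "finite X" using X(1) assms(1) finite_subset by blast
  \<comment> \<open>The common value of \<open>H a b\<close> is read off at the largest point. At
    \<open>a = Max X\<close> itself this is a harmless default, since no \<open>b\<close> in
    \<open>X\<close> lies above.\<close>
  define g where "g a = H a (Max X)" for a
  have g: "H a b = g a" if "a \<in> X" "b \<in> X" "a < b" for a b
  proof (cases "b = Max X")
    case False
    have M: "Max X \<in> X" "b \<le> Max X" using finX that by (auto intro: Max_in)
    hence "b < Max X" using False by simp
    hence "H a b \<subseteq> H a (Max X)" using mono'[of a b "Max X"] that M X(1) by blast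
    moreover have "card (H a b) = v" "card (H a (Max X)) = v"
      using v that M \<open>b < Max X\<close> by simp_all
    ultimately show ?thesis unfolding g_def using finH by (metis card_subset_eq)
  qed (simp add: g_def)
  have "g ` X \<subseteq> Pow {..<r}" by (auto simp: g_def H_def)
  then obtain L where L: "u \<le> card {a \<in> X. g a = L}"
    using large_fibre[OF finX, of "Pow {..<r}" g "2 ^ r" u] X(2) by (auto simp: card_Pow)
  then obtain Z where Z: "Z \<subseteq> {a \<in> X. g a = L}" "card Z = u"
    by (meson obtain_subset_with_card_n)
  have "G l a b = (l \<in> L)" if "l < r" "a \<in> Z" "b \<in> Z" "a < b" for l a b
    using g[of a b] that Z(1) by (auto simp: H_def)
  moreover have "Z \<subseteq> S" using Z(1) X(1) by blast
  ultimately show ?thesis using Z(2) by (intro exI[of _ Z] exI[of _ L]) simp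
qed

text \<open>With at least \<open>n\<close> values, pick one point for each; with fewer, one of the
  fibres has \<open>n\<close> points.\<close>

lemma const_or_injective:
  assumes "finite S" "n * n \<le> card S"
  shows "\<exists>X\<subseteq>S. card X = n \<and> ((\<forall>x\<in>X. \<forall>y\<in>X. f x = f y) \<or> inj_on f X)"
proof (cases "n \<le> card (f ` S)")
  case True
  obtain Y where "Y \<subseteq> S" "inj_on f Y" "f ` Y = f ` S"
    by (metis subset_image_inj subset_refl)
  moreover have "card Y = card (f ` Y)" using calculation(2) by (rule card_image[symmetric])
  ultimately show ?thesis
    using True by (metis inj_on_subset obtain_subset_with_card_n subset_trans)
next
  case False
  then obtain y where "n \<le> card {s \<in> S. f s = y}"
    using large_fibre[OF assms(1), of "f ` S" f n n] assms by auto
  then obtain Z where "Z \<subseteq> {s \<in> S. f s = y}" "card Z = n"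
    by (meson obtain_subset_with_card_n)
  then show ?thesis by (intro exI[of _ Z]) auto
qed

text \<open>If no \<open>b\<close> in the lower half \<open>J\<close> is related by all of \<open>Y\<close> to the least point \<open>z0\<close> of the upper
  half, then for some \<open>y\<close> many points of \<open>J\<close> are unrelated to \<open>z0\<close>, hence by monotonicity to each other.\<close>

lemma select_uniform:
  fixes F :: "'y \<Rightarrow> nat \<Rightarrow> nat \<Rightarrow> bool"
  assumes "finite Y" "card Y \<le> N" "N \<le> h" "finite S" "(2 * Suc h) ^ Suc N * t \<le> card S" "t > 0"
    and "\<And>y a b d. y \<in> Y \<Longrightarrow> a \<in> S \<Longrightarrow> b \<in> S \<Longrightarrow> d \<in> S \<Longrightarrow> a < b \<Longrightarrow> b < d \<Longrightarrow> F y a b \<Longrightarrow> F y a d"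
  shows "\<exists>b\<in>S. \<exists>S'\<subseteq>S. (\<forall>z\<in>S'. b < z) \<and> t \<le> card S' \<and>
      (\<forall>y\<in>Y. (\<forall>z\<in>S'. F y b z) \<or> (\<forall>a\<in>insert b S'. \<forall>z\<in>S'. a < z \<longrightarrow> \<not> F y a z))"
  using assms
proof (induction N arbitrary: Y S)
  case (0 Y S)
  then have "Y = {}" by auto
  have "2 * t \<le> card S"
  proof -
    have "2 * t \<le> (2 * Suc h) ^ Suc 0 * t" by simp
    also have "\<dots> \<le> card S" by fact
    finally show ?thesis .
  qed
  hence "Suc 0 \<le> card S" using "0.prems"(6) by linarith
  then obtain W where W: "W \<subseteq> S" "card W = Suc 0" "\<And>a b. a \<in> W \<Longrightarrow> b \<in> S - W \<Longrightarrow> a < b"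
    using split_initial[OF "0.prems"(4)] by metis
  then obtain b where b: "W = {b}" by (metis One_nat_def card_1_singletonE)
  have "t \<le> card (S - W)" using \<open>2 * t \<le> card S\<close> W "0.prems"(4,6) b by (simp add: card_Diff_subset)
  with W b \<open>Y = {}\<close> show ?case by (intro bexI[of _ b] exI[of _ "S - W"]) auto
next
  case (Suc N Y S)
  \<comment> \<open>Half of the assumed lower bound on \<open>card S\<close>. The factor
    \<open>Suc h\<close> pays for the pigeonhole over \<open>Y\<close>, and the rest is what the
    induction hypothesis asks for.\<close>
  define u where "u = (2 * Suc h) ^ Suc N * Suc h * t"
  have u: "2 * u \<le> card S" using Suc.prems(5) by (simp add: u_def algebra_simps)
  have pos: "1 \<le> (2 * Suc h) ^ Suc N * Suc h" by (simp add: Suc_le_eq del: power_Suc mult_Suc_right)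
  have "t \<le> u" using mult_le_mono1[OF pos, of t] by (simp only: u_def mult_1)
  hence "u > 0" using Suc.prems(6) by linarith
  obtain J where J: "J \<subseteq> S" "card J = u" "\<And>a b. a \<in> J \<Longrightarrow> b \<in> S - J \<Longrightarrow> a < b"
    using split_initial[OF Suc.prems(4), of u] u by auto
  define J' where "J' = S - J"
  have fin: "finite J" "finite J'" using J(1) Suc.prems(4) finite_subset by (auto simp: J'_def)
  have J': "J' \<subseteq> S" "u \<le> card J'"
    using u J(1,2) fin by (auto simp: J'_def card_Diff_subset)
  hence "J' \<noteq> {}" using \<open>u > 0\<close> by auto
  define z0 where "z0 = Min J'"
  have z0: "z0 \<in> J'" "\<And>z. z \<in> J' \<Longrightarrow> z0 \<le> z"
    using fin(2) \<open>J' \<noteq> {}\<close> by (auto simp: z0_def)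
  have lt: "a < z" if "a \<in> J" "z \<in> J'" for a z using J(3) that by (auto simp: J'_def)
  show ?case
  proof (cases "\<exists>b\<in>J. \<forall>y\<in>Y. F y b z0")
    case True
    then obtain b where b: "b \<in> J" "\<And>y. y \<in> Y \<Longrightarrow> F y b z0" by blast
    have "F y b z" if "y \<in> Y" "z \<in> J'" for y z
    proof (cases "z = z0")
      case False
      hence "z0 < z" using z0(2) that by (metis le_neq_implies_less)
      thus ?thesis using Suc.prems(7)[of y b z0 z] b that lt z0(1) J(1) J'(1) by blast
    qed (use b that in auto)
    then show ?thesis
      using b(1) J(1) J' lt \<open>t \<le> u\<close> by (intro bexI[of _ b] exI[of _ J']) auto
  next
    case False
    then obtain g where g: "\<And>b. b \<in> J \<Longrightarrow> g b \<in> Y \<and> \<not> F (g b) b z0" by metis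
    obtain y where y: "(2 * Suc h) ^ Suc N * t \<le> card {b \<in> J. g b = y}"
      using large_fibre[OF fin(1) Suc.prems(1), of g "Suc h" "(2 * Suc h) ^ Suc N * t"] g Suc.prems(2,3) J(2)
      by (auto simp: u_def algebra_simps)
    define K where "K = {b \<in> J. g b = y}"
    have KS: "K \<subseteq> S" using J(1) by (auto simp: K_def)
    have "0 < (2 * Suc h) ^ Suc N * t" using Suc.prems(6) by simp
    hence "0 < card K" using y unfolding K_def by linarith
    hence "K \<noteq> {}" by auto
    hence "y \<in> Y" using g by (auto simp: K_def)
    have nF: "\<not> F y a z" if "a \<in> K" "z \<in> K" "a < z" for a z
    proof
      assume "F y a z"
      moreover have "z < z0" using lt z0(1) that by (auto simp: K_def)
      ultimately have "F y a z0"
        using Suc.prems(7)[of y a z z0] \<open>y \<in> Y\<close> that KS z0(1) J'(1) by auto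
      thus False using g that by (auto simp: K_def)
    qed
    \<comment> \<open>On \<open>K\<close> the relation of this \<open>y\<close> is settled for good,
      so the induction goes on with one relation fewer.\<close>
    have "\<exists>b\<in>K. \<exists>S'\<subseteq>K. (\<forall>z\<in>S'. b < z) \<and> t \<le> card S' \<and>
      (\<forall>y\<in>Y - {y}. (\<forall>z\<in>S'. F y b z) \<or> (\<forall>a\<in>insert b S'. \<forall>z\<in>S'. a < z \<longrightarrow> \<not> F y a z))"
    proof (rule Suc.IH)
      show "finite (Y - {y})" "card (Y - {y}) \<le> N" "N \<le> h" "finite K" "0 < t"
        using Suc.prems \<open>y \<in> Y\<close> KS finite_subset by auto
      show "(2 * Suc h) ^ Suc N * t \<le> card K" using y by (simp add: K_def)
      show "\<And>y' a b d. y' \<in> Y - {y} \<Longrightarrow> a \<in> K \<Longrightarrow> b \<in> K \<Longrightarrow> d \<in> K \<Longrightarrow> a < b \<Longrightarrow> b < d \<Longrightarrow> F y' a b \<Longrightarrow> F y' a d"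
        using Suc.prems(7) KS by blast
    qed
    then obtain b S' where bS: "b \<in> K" "S' \<subseteq> K" "\<forall>z\<in>S'. b < z" "t \<le> card S'"
      "\<And>y'. y' \<in> Y - {y} \<Longrightarrow> (\<forall>z\<in>S'. F y' b z) \<or> (\<forall>a\<in>insert b S'. \<forall>z\<in>S'. a < z \<longrightarrow> \<not> F y' a z)"
      by blast
    have "(\<forall>z\<in>S'. F y' b z) \<or> (\<forall>a\<in>insert b S'. \<forall>z\<in>S'. a < z \<longrightarrow> \<not> F y' a z)" if "y' \<in> Y" for y'
      using bS(5)[of y'] that nF bS(1,2) by (cases "y' = y") blast+
    then show ?thesis using bS(1-4) KS by (intro bexI[of _ b] exI[of _ S']) auto
  qed
qed

section \<open>End-homogeneous subsets\<close>

abbreviation below :: "nat set \<Rightarrow> nat \<Rightarrow> bool" where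
  "below p z \<equiv> \<forall>a\<in>p. a < z"

definition last_mono :: "nat \<Rightarrow> nat \<Rightarrow> (nat \<Rightarrow> nat set \<Rightarrow> bool) \<Rightarrow> nat set \<Rightarrow> bool" where
  "last_mono i r E S \<longleftrightarrow> (\<forall>l<r. \<forall>y\<in>nsets S i. \<forall>z\<in>S. \<forall>z'\<in>S.
     below y z \<longrightarrow> z < z' \<longrightarrow> E l (insert z y) \<longrightarrow> E l (insert z' y))"

text \<open>The first clause serves to compare sets with the same last element, the second sets with
  different last elements. \<open>T\<close> is \<open>A\<close> together with the reservoir during
  the construction, and \<open>insert \<omega> A\<close> at its end, so a last element inside
  \<open>A\<close> can be traded for \<open>\<omega>\<close>.\<close>

definition end_homogeneous :: "(nat set \<Rightarrow> 'c) \<Rightarrow> nat \<Rightarrow> nat set \<Rightarrow> nat set \<Rightarrow> bool" where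
  "end_homogeneous c j A T \<longleftrightarrow>
     (\<forall>p\<in>nsets A j. \<forall>q\<in>nsets A j. \<forall>z\<in>T. \<forall>z'\<in>T. below (p \<union> q) z \<longrightarrow> below (p \<union> q) z' \<longrightarrow>
        (c (insert z p) = c (insert z q)) = (c (insert z' p) = c (insert z' q))) \<and>
     (\<forall>p\<in>nsets A j. \<forall>w\<in>nsets A (Suc j). \<forall>z\<in>T. \<forall>z'\<in>T. below (p \<union> w) z \<longrightarrow> below (p \<union> w) z' \<longrightarrow>
        (c (insert z p) = c w) = (c (insert z' p) = c w))"

text \<open>A numerical cut-off says at once that \<open>E\<close> does not depend on the last
  element \<open>z\<close> and that it is decreasing in \<open>b\<close>. It need not be a point of
  \<open>A\<close>.\<close>

definition threshold_at ::
    "(nat \<Rightarrow> nat set \<Rightarrow> bool) \<Rightarrow> nat set \<Rightarrow> nat set \<Rightarrow> nat \<Rightarrow> nat set \<Rightarrow> nat \<Rightarrow> bool" where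
  "threshold_at E A T l y \<theta> \<longleftrightarrow> (\<forall>b\<in>A. \<forall>z\<in>T. below y b \<longrightarrow> b < z \<longrightarrow> E l (insert z (insert b y)) = (b < \<theta>))"

text \<open>The disjunction says which phase the pair \<open>(l, y)\<close> is in: \<open>E\<close> has held for all chosen \<open>b\<close> so far,
  or \<open>E\<close> fails for all further choices from \<open>S\<close>.\<close>

definition reservoir ::
    "(nat set \<Rightarrow> 'c) \<Rightarrow> nat \<Rightarrow> (nat \<Rightarrow> nat set \<Rightarrow> bool) \<Rightarrow> nat \<Rightarrow> nat set \<Rightarrow> nat set \<Rightarrow> bool" where
  "reservoir c r E j A S \<longleftrightarrow> (\<forall>s\<in>S. below A s) \<and> end_homogeneous c j A (A \<union> S) \<and>
     (\<forall>l<r. \<forall>y\<in>nsets A j. \<exists>\<theta>. threshold_at E A (A \<union> S) l y \<theta> \<and>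
        (below A \<theta> \<or> (\<forall>s\<in>S. \<theta> \<le> s) \<and> (\<forall>b\<in>S. \<forall>z\<in>S. b < z \<longrightarrow> \<not> E l (insert z (insert b y)))))"

lemma end_homogeneousD1:
  assumes "end_homogeneous c j A T" "p \<in> nsets A j" "q \<in> nsets A j" "z \<in> T" "z' \<in> T"
    "below (p \<union> q) z" "below (p \<union> q) z'"
  shows "(c (insert z p) = c (insert z q)) = (c (insert z' p) = c (insert z' q))"
  using conjunct1[OF assms(1)[unfolded end_homogeneous_def], THEN bspec, OF assms(2), THEN bspec,
      OF assms(3), THEN bspec, OF assms(4), THEN bspec, OF assms(5)] assms(6,7) by (elim mp[THEN mp])

lemma end_homogeneousD2:
  assumes "end_homogeneous c j A T" "p \<in> nsets A j" "w \<in> nsets A (Suc j)" "z \<in> T" "z' \<in> T"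
    "below (p \<union> w) z" "below (p \<union> w) z'"
  shows "(c (insert z p) = c w) = (c (insert z' p) = c w)"
  using conjunct2[OF assms(1)[unfolded end_homogeneous_def], THEN bspec, OF assms(2), THEN bspec,
      OF assms(3), THEN bspec, OF assms(4), THEN bspec, OF assms(5)] assms(6,7) by (elim mp[THEN mp])

lemma end_homogeneousI:
  assumes "\<And>p q z z'. p \<in> nsets A j \<Longrightarrow> q \<in> nsets A j \<Longrightarrow> z \<in> T \<Longrightarrow> z' \<in> T \<Longrightarrow>
      below (p \<union> q) z \<Longrightarrow> below (p \<union> q) z' \<Longrightarrow>
      (c (insert z p) = c (insert z q)) = (c (insert z' p) = c (insert z' q))"
    and "\<And>p w z z'. p \<in> nsets A j \<Longrightarrow> w \<in> nsets A (Suc j) \<Longrightarrow> z \<in> T \<Longrightarrow> z' \<in> T \<Longrightarrow>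
      below (p \<union> w) z \<Longrightarrow> below (p \<union> w) z' \<Longrightarrow> (c (insert z p) = c w) = (c (insert z' p) = c w)"
  shows "end_homogeneous c j A T"
  unfolding end_homogeneous_def by (intro conjI ballI impI) (fact assms)+

lemma end_homogeneous_mono:
  assumes eh: "end_homogeneous c j A T" and sub: "T' \<subseteq> T"
  shows "end_homogeneous c j A T'"
proof (rule end_homogeneousI)
  show "(c (insert z p) = c (insert z q)) = (c (insert z' p) = c (insert z' q))"
    if "p \<in> nsets A j" "q \<in> nsets A j" "z \<in> T'" "z' \<in> T'" "below (p \<union> q) z" "below (p \<union> q) z'" for p q z z'
    using end_homogeneousD1[OF eh that(1,2) _ _ that(5,6)] that(3,4) sub by (simp add: subset_iff)
  show "(c (insert z p) = c w) = (c (insert z' p) = c w)"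
    if "p \<in> nsets A j" "w \<in> nsets A (Suc j)" "z \<in> T'" "z' \<in> T'" "below (p \<union> w) z" "below (p \<union> w) z'" for p w z z'
    using end_homogeneousD2[OF eh that(1,2) _ _ that(5,6)] that(3,4) sub by (simp add: subset_iff)
qed

lemma threshold_at_mono: "threshold_at E A T l y \<theta> \<Longrightarrow> T' \<subseteq> T \<Longrightarrow> threshold_at E A T' l y \<theta>"
  unfolding threshold_at_def by blast

text \<open>Recording for each \<open>p\<close> only the class of \<open>c(p z)\<close>, instead of a truth value for every pair, keeps the
  loss at \<open>2^O(m^j log m)\<close>; the exponent \<open>6k\<close> depends on this.\<close>

lemma refine_types:
  fixes c :: "nat set \<Rightarrow> 'c"
  assumes "finite A" "card A \<le> m" "m > 0" "finite S" "(2 * m ^ Suc j) ^ m ^ j * t \<le> card S"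
  shows "\<exists>S'\<subseteq>S. t \<le> card S' \<and> (\<forall>z\<in>S'. \<forall>z'\<in>S'.
     (\<forall>p\<in>nsets A j. \<forall>q\<in>nsets A j. (c (insert z p) = c (insert z q)) = (c (insert z' p) = c (insert z' q))) \<and>
     (\<forall>p\<in>nsets A j. \<forall>w\<in>nsets A (Suc j). (c (insert z p) = c w) = (c (insert z' p) = c w)))"
proof -
  define P where "P = nsets A j"
  define W where "W = nsets A (Suc j)"
  have fin: "finite P" "finite W" using assms(1) by (auto simp: P_def W_def finite_imp_finite_nsets)
  have cards: "card P \<le> m ^ j" "card W \<le> m ^ Suc j"
    using card_nsets_le[OF assms(1,2)] unfolding P_def W_def by blast+
  \<comment> \<open>A chosen member of the class of all \<open>q\<close> whose extension by
    \<open>z\<close> has colour \<open>a\<close>.\<close>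
  define rep where "rep z a = (SOME q. q \<in> P \<and> c (insert z q) = a)" for z a
  have rep: "rep z (c (insert z p)) \<in> P \<and> c (insert z (rep z (c (insert z p)))) = c (insert z p)"
    if "p \<in> P" for z p
    unfolding rep_def by (rule someI[of _ p]) (use that in auto)
  \<comment> \<open>The type of \<open>z\<close>: a colour already seen on \<open>W\<close> is
    recorded itself, any other colour only through the representative of its class. Hence there are
    few types, and a type still determines all the equalities in question.\<close>
  define g where "g z = restrict (\<lambda>p. if c (insert z p) \<in> c ` W then Inl (c (insert z p))
      else Inr (rep z (c (insert z p)))) P" for z
  define T where "T = P \<rightarrow>\<^sub>E (Inl ` c ` W \<union> Inr ` P)"
  have finT: "finite T" unfolding T_def using fin by (intro finite_PiE) auto
  have "card (Inl ` c ` W \<union> Inr ` P :: ('c + nat set) set) \<le> card (Inl ` c ` W :: ('c + nat set) set) + card (Inr ` P :: ('c + nat set) set)"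
    by (rule card_Un_le)
  also have "\<dots> \<le> card W + card P"
    by (intro add_mono order_trans[OF card_image_le] card_image_le fin) (auto intro: fin card_image_le)
  also have "\<dots> \<le> m ^ Suc j + m ^ Suc j"
    using cards assms(3) by (intro add_mono) (auto intro: order_trans)
  finally have "card (Inl ` c ` W \<union> Inr ` P :: ('c + nat set) set) \<le> 2 * m ^ Suc j" by simp
  moreover have "card T = card (Inl ` c ` W \<union> Inr ` P :: ('c + nat set) set) ^ card P"
    unfolding T_def using fin(1) by (simp add: card_PiE)
  ultimately have "card T \<le> (2 * m ^ Suc j) ^ card P"
    using power_mono by (metis le0)
  also have "\<dots> \<le> (2 * m ^ Suc j) ^ m ^ j"
    using cards(1) assms(3) by (intro power_increasing) auto
  finally have cT: "card T \<le> (2 * m ^ Suc j) ^ m ^ j" .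
  have "g ` S \<subseteq> T"
    unfolding T_def g_def using rep by auto
  moreover have "0 < (2 * m ^ Suc j) ^ m ^ j" using assms(3) by simp
  ultimately obtain f where f: "t \<le> card {s \<in> S. g s = f}"
    by (rule large_fibre[OF assms(4) finT _ cT assms(5)])
  have g: "g z p = (if c (insert z p) \<in> c ` W then Inl (c (insert z p)) else Inr (rep z (c (insert z p))))"
    if "p \<in> P" for z p using that by (simp add: g_def)
  have iff1: "(c (insert z p) = c (insert z q)) \<longleftrightarrow> g z p = g z q" if pq: "p \<in> P" "q \<in> P" for z p q
  proof
    assume "g z p = g z q"
    hence "(if c (insert z p) \<in> c ` W then Inl (c (insert z p)) else Inr (rep z (c (insert z p)))) =
       (if c (insert z q) \<in> c ` W then Inl (c (insert z q)) else Inr (rep z (c (insert z q))))"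
      using g[OF pq(1), of z] g[OF pq(2), of z] by argo
    hence "c (insert z p) = c (insert z q) \<or> rep z (c (insert z p)) = rep z (c (insert z q))"
      by (cases "c (insert z p) \<in> c ` W"; cases "c (insert z q) \<in> c ` W") simp_all
    thus "c (insert z p) = c (insert z q)"
      using rep[OF pq(1), of z] rep[OF pq(2), of z] by metis
  qed (use g pq in simp)
  have iff2: "(c (insert z p) = c w) \<longleftrightarrow> g z p = Inl (c w)" if "p \<in> P" "w \<in> W" for z p w
    using g[OF that(1), of z] that(2) by auto
  show ?thesis
  proof (intro exI[of _ "{s \<in> S. g s = f}"] conjI ballI)
    fix z z' p q assume "z \<in> {s \<in> S. g s = f}" "z' \<in> {s \<in> S. g s = f}" "p \<in> nsets A j" "q \<in> nsets A j"
    thus "(c (insert z p) = c (insert z q)) = (c (insert z' p) = c (insert z' q))"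
      using iff1[of p q z] iff1[of p q z'] by (simp add: P_def)
  next
    fix z z' p w assume "z \<in> {s \<in> S. g s = f}" "z' \<in> {s \<in> S. g s = f}" "p \<in> nsets A j" "w \<in> nsets A (Suc j)"
    thus "(c (insert z p) = c w) = (c (insert z' p) = c w)"
      using iff2[of p w z] iff2[of p w z'] by (simp add: P_def W_def)
  qed (use f in auto)
qed

text \<open>One greedy step. \<open>select_uniform\<close> picks \<open>v\<close> and decides the
  phase of each pair \<open>(l, y)\<close>, of which there are at most \<open>h\<close>; then
  \<open>refine_types\<close> makes the remaining points agree on colours. Sets avoiding
  \<open>v\<close> inherit the old properties, and sets containing \<open>v\<close> are only
  extended by points of \<open>S'\<close>.\<close>

lemma reservoir_extend:
  fixes c :: "nat set \<Rightarrow> 'c"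
  assumes res: "reservoir c r E j A S" and fin: "finite A" "finite S" and "card A < m"
    and mono: "last_mono (Suc j) r E (A \<union> S)"
    and h: "h = r * m ^ j"
    and size: "(2 * Suc h) ^ Suc h * ((2 * m ^ Suc j) ^ m ^ j * t) \<le> card S" and "t > 0"
  shows "\<exists>v\<in>S. \<exists>S'\<subseteq>S. reservoir c r E j (insert v A) S' \<and> t \<le> card S'"
proof -
  have "m > 0" using \<open>card A < m\<close> by simp
  define Y where "Y = {..<r} \<times> nsets A j"
  define F where "F = (\<lambda>(l, y) b z. E l (insert z (insert b y)))"
  have AS: "a < s" if "a \<in> A" "s \<in> S" for a s using res that by (auto simp: reservoir_def)
  have finY: "finite Y" by (simp add: Y_def finite_imp_finite_nsets fin)
  have "card (nsets A j) \<le> m ^ j" using card_nsets_le fin(1) \<open>card A < m\<close> by (metis less_imp_le)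
  hence cY: "card Y \<le> h" by (simp add: Y_def card_cartesian_product h)
  have Fmono: "F y a d" if y_in: "y \<in> Y" and "a \<in> S" "b \<in> S" "d \<in> S" "a < b" "b < d" "F y a b" for y a b d
  proof -
    obtain l y0 where y: "y = (l, y0)" "l < r" "y0 \<in> nsets A j" using y_in by (auto simp: Y_def)
    have "a \<notin> y0" using AS[of a a] that(2) y(3) by (auto simp: nsets_def)
    hence "insert a y0 \<in> nsets (A \<union> S) (Suc j)" using y(3) that(2) by (auto simp: nsets_def)
    moreover have "below (insert a y0) b" using AS y(3) that by (auto simp: nsets_def)
    moreover have "E l (insert b (insert a y0))" using that y(1) by (simp add: F_def)
    ultimately have "E l (insert d (insert a y0))"
      using mono y(2) \<open>b \<in> S\<close> \<open>d \<in> S\<close> \<open>b < d\<close> unfolding last_mono_def by blast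
    thus ?thesis using y(1) by (simp add: F_def)
  qed
  have pos: "0 < (2 * m ^ Suc j) ^ m ^ j * t" using \<open>m > 0\<close> \<open>t > 0\<close> by simp
  have "\<exists>v\<in>S. \<exists>S1\<subseteq>S. (\<forall>z\<in>S1. v < z) \<and> (2 * m ^ Suc j) ^ m ^ j * t \<le> card S1 \<and>
      (\<forall>y\<in>Y. (\<forall>z\<in>S1. F y v z) \<or> (\<forall>a\<in>insert v S1. \<forall>z\<in>S1. a < z \<longrightarrow> \<not> F y a z))"
    using Fmono by (rule select_uniform[OF finY cY order_refl fin(2) size pos])
  then obtain v S1 where v: "v \<in> S" "S1 \<subseteq> S" "\<forall>z\<in>S1. v < z" "(2 * m ^ Suc j) ^ m ^ j * t \<le> card S1"
    and F: "\<And>y. y \<in> Y \<Longrightarrow> (\<forall>z\<in>S1. F y v z) \<or> (\<forall>a\<in>insert v S1. \<forall>z\<in>S1. a < z \<longrightarrow> \<not> F y a z)"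
    by blast
  define A' where "A' = insert v A"
  have A': "finite A'" "card A' \<le> m" "finite S1"
    using fin \<open>card A < m\<close> v(2) finite_subset by (auto simp: A'_def card_insert_if)
  obtain S' where S': "S' \<subseteq> S1" "t \<le> card S'"
    and hom1: "\<And>z z' p q. z \<in> S' \<Longrightarrow> z' \<in> S' \<Longrightarrow> p \<in> nsets A' j \<Longrightarrow> q \<in> nsets A' j \<Longrightarrow>
       (c (insert z p) = c (insert z q)) = (c (insert z' p) = c (insert z' q))"
    and hom2: "\<And>z z' p w. z \<in> S' \<Longrightarrow> z' \<in> S' \<Longrightarrow> p \<in> nsets A' j \<Longrightarrow> w \<in> nsets A' (Suc j) \<Longrightarrow>
       (c (insert z p) = c w) = (c (insert z' p) = c w)"
    using refine_types[OF A'(1,2) \<open>m > 0\<close> A'(3) v(4), of c] by blast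
  have S'S: "S' \<subseteq> S" using S'(1) v(2) by blast
  have vS': "v < s" if "s \<in> S'" for s using v(3) S'(1) that by blast
  have Av: "a < v" if "a \<in> A" for a using AS that v(1) by blast
  have old: "p \<in> nsets A k" if "p \<in> nsets A' k" "v \<notin> p" for p k
    using that by (auto simp: nsets_def A'_def)
  have inT: "z \<in> A \<union> S" if "z \<in> A' \<union> S'" for z using that v(1) S'S by (auto simp: A'_def)
  have new: "z \<in> S'" if "z \<in> A' \<union> S'" "v < z" for z using that Av[of z] by (auto simp: A'_def)
  have eh: "end_homogeneous c j A (A \<union> S)" using res by (simp add: reservoir_def)
  have "end_homogeneous c j A' (A' \<union> S')"
  proof (rule end_homogeneousI)
    fix p q z z' assume pq: "p \<in> nsets A' j" "q \<in> nsets A' j" and z: "z \<in> A' \<union> S'" "z' \<in> A' \<union> S'"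
      and b: "below (p \<union> q) z" "below (p \<union> q) z'"
    show "(c (insert z p) = c (insert z q)) = (c (insert z' p) = c (insert z' q))"
    proof (cases "v \<in> p \<union> q")
      case True
      then show ?thesis using hom1 new pq z b by blast
    next
      case False
      hence "p \<in> nsets A j" "q \<in> nsets A j" using old pq by auto
      then show ?thesis using eh inT[OF z(1)] inT[OF z(2)] b by (intro end_homogeneousD1)
    qed
  next
    fix p w z z' assume pw: "p \<in> nsets A' j" "w \<in> nsets A' (Suc j)" and z: "z \<in> A' \<union> S'" "z' \<in> A' \<union> S'"
      and b: "below (p \<union> w) z" "below (p \<union> w) z'"
    show "(c (insert z p) = c w) = (c (insert z' p) = c w)"
    proof (cases "v \<in> p \<union> w")
      case True
      then show ?thesis using hom2 new pw z b by blast
    next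
      case False
      hence "p \<in> nsets A j" "w \<in> nsets A (Suc j)" using old pw by auto
      then show ?thesis using eh inT[OF z(1)] inT[OF z(2)] b by (intro end_homogeneousD2)
    qed
  qed
  moreover have "\<exists>\<theta>. threshold_at E A' (A' \<union> S') l y \<theta> \<and>
        (below A' \<theta> \<or> (\<forall>s\<in>S'. \<theta> \<le> s) \<and> (\<forall>b\<in>S'. \<forall>z\<in>S'. b < z \<longrightarrow> \<not> E l (insert z (insert b y))))"
    if l: "l < r" and y: "y \<in> nsets A' j" for l y
  proof (cases "v \<in> y")
    case True
    \<comment> \<open>No point of \<open>A'\<close> lies above \<open>y\<close>, so any threshold
      would do; \<open>Suc v\<close> lies above \<open>A'\<close> and puts the pair into the first
      phase.\<close>
    have "threshold_at E A' (A' \<union> S') l y (Suc v)"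
    proof -
      have "\<not> below y b" if "b \<in> A'" for b
      proof
        assume "below y b"
        hence "v < b" using True by blast
        thus False using Av[of b] that by (auto simp: A'_def)
      qed
      thus ?thesis unfolding threshold_at_def by blast
    qed
    then show ?thesis using Av by (intro exI[of _ "Suc v"]) (auto simp: A'_def less_Suc_eq)
  next
    case False
    hence yA: "y \<in> nsets A j" using old y by blast
    then obtain \<theta> where th: "threshold_at E A (A \<union> S) l y \<theta>"
      and st: "below A \<theta> \<or> (\<forall>s\<in>S. \<theta> \<le> s) \<and> (\<forall>b\<in>S. \<forall>z\<in>S. b < z \<longrightarrow> \<not> E l (insert z (insert b y)))"
      using res l unfolding reservoir_def by blast
    have E_old: "E l (insert z (insert b y)) = (b < \<theta>)"
      if "b \<in> A" "z \<in> A' \<union> S'" "below y b" "b < z" for b z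
      using th inT that unfolding threshold_at_def by blast
    have split: "threshold_at E A' (A' \<union> S') l y \<theta>'"
      if "\<And>b. b \<in> A \<Longrightarrow> (b < \<theta>) = (b < \<theta>')" "\<And>z. z \<in> S' \<Longrightarrow> E l (insert z (insert v y)) = (v < \<theta>')" for \<theta>'
      unfolding threshold_at_def
    proof (intro ballI impI)
      fix b z assume b: "b \<in> A'" "z \<in> A' \<union> S'" "below y b" "b < z"
      show "E l (insert z (insert b y)) = (b < \<theta>')"
      proof (cases "b = v")
        case True
        with b(4) new[OF b(2)] that(2)[of z] show ?thesis by simp
      next
        case False
        hence "b \<in> A" using b(1) by (simp add: A'_def)
        with E_old[OF this b(2-4)] that(1) show ?thesis by simp
      qed
    qed
    show ?thesis
    proof (cases "below A \<theta>")
      case False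
      hence F': "\<forall>s\<in>S. \<theta> \<le> s" "\<forall>b\<in>S. \<forall>z\<in>S. b < z \<longrightarrow> \<not> E l (insert z (insert b y))" using st by auto
      \<comment> \<open>In the second phase the old threshold stays: \<open>E\<close> fails at
        \<open>v\<close>, and \<open>\<theta> \<le> v\<close>.\<close>
      have "threshold_at E A' (A' \<union> S') l y \<theta>"
        using split[of \<theta>] F' v(1) vS' S'S by (meson in_mono leD)
      with F' S'S show ?thesis by blast
    next
      case True
      \<comment> \<open>In the first phase \<open>v\<close> decides: if \<open>E\<close> holds at
        \<open>v\<close>, the threshold moves up to \<open>Suc v\<close> and the phase continues;
        otherwise it is fixed at \<open>v\<close> and the second phase begins.\<close>
      have "(l, y) \<in> Y" using l yA by (simp add: Y_def)
      from F[OF this] show ?thesis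
      proof
        assume "\<forall>z\<in>S1. F (l, y) v z"
        hence "threshold_at E A' (A' \<union> S') l y (Suc v)"
          using split[of "Suc v"] True Av S'(1) by (auto simp: F_def less_SucI)
        thus ?thesis using Av by (intro exI[of _ "Suc v"]) (auto simp: A'_def less_Suc_eq)
      next
        assume *: "\<forall>a\<in>insert v S1. \<forall>z\<in>S1. a < z \<longrightarrow> \<not> F (l, y) a z"
        have "\<not> E l (insert z (insert v y))" if "z \<in> S'" for z
          using * S'(1) vS'[OF that] that by (auto simp: F_def)
        hence "threshold_at E A' (A' \<union> S') l y v"
          using split[of v] True Av by auto
        thus ?thesis using * S'(1) vS'
          by (intro exI[of _ v]) (auto simp: F_def less_imp_le subset_iff)
      qed
    qed
  qed
  moreover have "\<forall>s\<in>S'. below A' s" using AS S'S vS' by (auto simp: A'_def)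
  ultimately have "reservoir c r E j A' S'" unfolding reservoir_def by blast
  then show ?thesis using v(1) S'S S'(2) unfolding A'_def by blast
qed

text \<open>The factor by which the reservoir shrinks in one step: the loss in
  \<open>select_uniform\<close> times the loss in \<open>refine_types\<close>.\<close>

definition step_loss :: "nat \<Rightarrow> nat \<Rightarrow> nat \<Rightarrow> nat" where
  "step_loss r j m = (2 * Suc (r * m ^ j)) ^ Suc (r * m ^ j) * (2 * m ^ Suc j) ^ m ^ j"

text \<open>Extends the empty set \<open>m\<close> times, each time dividing the reservoir by
  \<open>step_loss r j m\<close>; \<open>\<omega>\<close> is a point that is left over.\<close>

lemma end_homogeneous_subset:
  fixes c :: "nat set \<Rightarrow> 'c"
  assumes "finite S" and mono: "last_mono (Suc j) r E S" and "j > 0"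
    and "step_loss r j m ^ m \<le> card S" "m > 0"
  shows "\<exists>A \<omega>. A \<subseteq> S \<and> \<omega> \<in> S \<and> card A = m \<and> below A \<omega> \<and>
     end_homogeneous c j A (insert \<omega> A) \<and>
     (\<forall>l<r. \<forall>y\<in>nsets A j. \<exists>\<theta>. threshold_at E A (insert \<omega> A) l y \<theta>)"
proof -
  let ?K = "step_loss r j m"
  have "0 < (2 * Suc x) ^ n" for x n :: nat by simp
  moreover have "0 < (2 * m ^ Suc j) ^ m ^ j" using \<open>m > 0\<close> by simp
  ultimately have K: "?K > 0" unfolding step_loss_def by (rule mult_pos_pos)
  have "\<exists>A S'. A \<subseteq> S \<and> S' \<subseteq> S \<and> card A = n \<and> reservoir c r E j A S' \<and> ?K ^ (m - n) \<le> card S'"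
    if "n \<le> m" for n
    using that
  proof (induction n)
    case 0
    \<comment> \<open>Since \<open>j > 0\<close>, every condition on \<open>j\<close>-subsets of the
      empty set is vacuous.\<close>
    have "nsets {} k = {}" if "k > 0" for k :: nat using that by (auto simp: nsets_def)
    hence "reservoir c r E j {} S"
      using \<open>j > 0\<close> by (auto simp: reservoir_def end_homogeneous_def)
    then show ?case using assms(4) by (intro exI[of _ "{}"] exI[of _ S]) auto
  next
    case (Suc n)
    then obtain A S' where AS: "A \<subseteq> S" "S' \<subseteq> S" "card A = n" "reservoir c r E j A S'" "?K ^ (m - n) \<le> card S'"
      by auto
    have fin: "finite A" "finite S'" using AS assms(1) finite_subset by auto
    have "A \<union> S' \<subseteq> S" using AS by blast
    hence "last_mono (Suc j) r E (A \<union> S')"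
      using mono nsets_mono[of "A \<union> S'" S "Suc j"] unfolding last_mono_def by (meson subsetD)
    moreover have "?K * ?K ^ (m - Suc n) \<le> card S'"
      using AS(5) Suc.prems by (simp add: Suc_diff_Suc flip: power_Suc)
    ultimately obtain v S'' where "v \<in> S'" "S'' \<subseteq> S'" "reservoir c r E j (insert v A) S''" "?K ^ (m - Suc n) \<le> card S''"
      using reservoir_extend[OF AS(4) fin, of m "r * m ^ j" "?K ^ (m - Suc n)"] Suc.prems AS(3) K
      by (auto simp: step_loss_def mult.assoc)
    moreover have "v \<notin> A" using AS(4) \<open>v \<in> S'\<close> by (auto simp: reservoir_def)
    ultimately show ?case
      using AS fin by (intro exI[of _ "insert v A"] exI[of _ S'']) auto
  qed
  from this[of m] obtain A S' where AS: "A \<subseteq> S" "S' \<subseteq> S" "card A = m" "reservoir c r E j A S'" "1 \<le> card S'"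
    by auto
  then obtain \<omega> where w: "\<omega> \<in> S'" by (metis card.empty ex_in_conv not_one_le_zero)
  have sub: "insert \<omega> A \<subseteq> A \<union> S'" using w by blast
  have "end_homogeneous c j A (A \<union> S')" using AS(4) by (simp add: reservoir_def)
  hence "end_homogeneous c j A (insert \<omega> A)" using sub by (rule end_homogeneous_mono)
  moreover have "\<exists>\<theta>. threshold_at E A (insert \<omega> A) l y \<theta>" if "l < r" "y \<in> nsets A j" for l y
  proof -
    obtain \<theta> where "threshold_at E A (A \<union> S') l y \<theta>"
      using AS(4) \<open>l < r\<close> \<open>y \<in> nsets A j\<close> unfolding reservoir_def by blast
    thus ?thesis using threshold_at_mono sub by blast
  qed
  moreover have "below A \<omega>" using AS(4) w by (auto simp: reservoir_def)
  ultimately show ?thesis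
    using AS(1-3) w by (intro exI[of _ A] exI[of _ \<omega>]) blast
qed

section \<open>Lifting canonical sets\<close>

lemma sorted_list_of_set_insert_max:
  assumes "finite p" "below p z"
  shows "sorted_list_of_set (insert z p) = sorted_list_of_set p @ [z]"
proof (rule strict_sorted_equal)
  show "sorted_wrt (<) (sorted_list_of_set p @ [z])"
    using assms by (simp add: sorted_wrt_append)
  have "set (sorted_list_of_set (insert z p)) = insert z p"
    using assms(1) by (intro set_sorted_list_of_set) simp
  thus "set (sorted_list_of_set (insert z p)) = set (sorted_list_of_set p @ [z])"
    using assms(1) by (metis Un_insert_right list.simps(15) set_append set_empty set_sorted_list_of_set sup_bot_right)
qed (rule strict_sorted_list_of_set)

lemma nth_least_insert_max:
  assumes "finite p" "card p = j" "below p z"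
  shows "nth_least (insert z p) (Suc j) = z"
    and "l \<in> {1..j} \<Longrightarrow> nth_least (insert z p) l = nth_least p l"
  unfolding nth_least_def sorted_list_of_set_insert_max[OF assms(1,3)]
  using assms(1,2) by (auto simp: nth_append)

lemma canonical_eq_insert_max:
  assumes "I \<subseteq> {1..j}" "finite p" "card p = j" "below p z" "finite q" "card q = j" "below q z'"
  shows "canonical_eq I (insert z p) (insert z' q) \<longleftrightarrow> canonical_eq I p q"
    and "canonical_eq (insert (Suc j) I) (insert z p) (insert z' q) \<longleftrightarrow> z = z' \<and> canonical_eq I p q"
  using assms(1) nth_least_insert_max[OF assms(2-4)] nth_least_insert_max[OF assms(5-7)]
  by (auto simp: canonical_eq_def subset_iff)

lemma nsets_Suc_maxE:
  fixes X :: "nat set"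
  assumes "x \<in> nsets X (Suc j)"
  obtains z p where "x = insert z p" "z \<in> X" "p \<in> nsets X j" "below p z"
proof (rule that)
  have x: "finite x" "x \<noteq> {}" "x \<subseteq> X" "card x = Suc j" using assms by (auto simp: nsets_def)
  hence M: "Max x \<in> x" by simp
  show "x = insert (Max x) (x - {Max x})" using M by blast
  show "Max x \<in> X" using M x by blast
  show "x - {Max x} \<in> nsets X j" using M x by (auto simp: nsets_def)
  show "below (x - {Max x}) (Max x)" using x by (auto simp: less_le)
qed

text \<open>The relations are asked to be constant because the truth value of the relation added in
  the step down decides whether the last position belongs to \<open>I\<close>.\<close>

definition canon_set ::
    "nat \<Rightarrow> nat \<Rightarrow> (nat set \<Rightarrow> 'c) \<Rightarrow> (nat \<Rightarrow> nat set \<Rightarrow> bool) \<Rightarrow> nat set \<Rightarrow> bool" where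
  "canon_set i r c E X \<longleftrightarrow>
     (\<exists>I\<subseteq>{1..i}. \<forall>x\<in>nsets X i. \<forall>y\<in>nsets X i. c x = c y \<longleftrightarrow> canonical_eq I x y) \<and>
     (\<forall>l<r. \<forall>x\<in>nsets X (Suc i). \<forall>y\<in>nsets X (Suc i). E l x = E l y)"

text \<open>The negation restores upward monotonicity. The new relation with index \<open>r\<close> holds iff the threshold of
  the colour of \<open>x - {Max x}\<close> is at most \<open>Max x\<close>.\<close>

definition derived_rel ::
    "(nat set \<Rightarrow> 'c) \<Rightarrow> (nat \<Rightarrow> nat set \<Rightarrow> bool) \<Rightarrow> nat \<Rightarrow> nat \<Rightarrow> nat \<Rightarrow> nat set \<Rightarrow> bool" where
  "derived_rel c E r \<omega> l x \<longleftrightarrow>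
     (if l < r then \<not> E l (insert \<omega> x) else c x = c (insert \<omega> (x - {Max x})))"

lemma derived_rel_last:
  assumes "finite p" "below p z"
  shows "derived_rel c E r \<omega> r (insert z p) \<longleftrightarrow> c (insert z p) = c (insert \<omega> p)"
proof -
  have "Max (insert z p) = z" using assms by (intro Max_eqI) auto
  moreover have "insert z p - {z} = p" using assms by auto
  ultimately show ?thesis by (simp add: derived_rel_def)
qed

lemma insert_in_nsets: "p \<in> nsets A j \<Longrightarrow> z \<in> A \<Longrightarrow> below p z \<Longrightarrow> insert z p \<in> nsets A (Suc j)"
  by (auto simp: nsets_def card_insert_if)

text \<open>For \<open>l < r\<close> the threshold makes \<open>E\<close> with last element
  \<open>\<omega>\<close> decreasing in the element before it, so its negation is increasing. For
  \<open>l = r\<close>, if extending \<open>y\<close> by \<open>z\<close> gives the same colour as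
  extending it by \<open>\<omega>\<close>, then end-homogeneity lets \<open>z'\<close> take the
  place of \<open>\<omega>\<close> in this equation.\<close>

lemma last_mono_derived:
  fixes c :: "nat set \<Rightarrow> 'c"
  assumes \<omega>: "below A \<omega>" and eh: "end_homogeneous c j A (insert \<omega> A)"
    and thr: "\<forall>l<r. \<forall>y\<in>nsets A j. \<exists>\<theta>. threshold_at E A (insert \<omega> A) l y \<theta>"
  shows "last_mono j (Suc r) (derived_rel c E r \<omega>) A"
  unfolding last_mono_def
proof (intro allI impI ballI)
  fix l y z z'
  assume l: "l < Suc r" and y: "y \<in> nsets A j" and z: "z \<in> A" "z' \<in> A" "below y z" "z < z'"
    and R: "derived_rel c E r \<omega> l (insert z y)"
  have fin: "finite y" and sub: "y \<subseteq> A" using y by (auto simp: nsets_def)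
  have z': "below y z'" using z by (meson less_trans)
  show "derived_rel c E r \<omega> l (insert z' y)"
  proof (cases "l < r")
    case True
    then obtain \<theta> where th: "threshold_at E A (insert \<omega> A) l y \<theta>" using thr y by blast
    have "E l (insert \<omega> (insert b y)) = (b < \<theta>)" if "b \<in> A" "below y b" for b
      using th that \<omega> unfolding threshold_at_def by blast
    with R True z z' show ?thesis by (simp add: derived_rel_def)
  next
    case False
    hence "l = r" using l by simp
    have "c (insert z y) = c (insert \<omega> y)"
      using R derived_rel_last[OF fin z(3)] \<open>l = r\<close> by metis
    moreover have "(c (insert z' y) = c (insert z y)) = (c (insert \<omega> y) = c (insert z y))"
      by (rule end_homogeneousD2[OF eh y insert_in_nsets[OF y z(1,3)]]) (use z z' \<omega> sub in auto)
    ultimately show ?thesis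
      using derived_rel_last[OF fin z'] \<open>l = r\<close> by metis
  qed
qed

text \<open>The new relation is constant on \<open>X\<close>. If it holds, the last element of a set
  may be replaced by \<open>\<omega>\<close> without changing the colour, so the same
  \<open>I\<close> works. If it fails, sets with different last elements have different colours, and
  \<open>Suc j\<close> joins \<open>I\<close>.\<close>

lemma canon_set_lift:
  fixes c :: "nat set \<Rightarrow> 'c"
  assumes \<omega>: "below A \<omega>" and eh: "end_homogeneous c j A (insert \<omega> A)"
    and thr: "\<forall>l<r. \<forall>y\<in>nsets A j. \<exists>\<theta>. threshold_at E A (insert \<omega> A) l y \<theta>"
    and X: "X \<subseteq> A" and canon: "canon_set j (Suc r) (\<lambda>p. c (insert \<omega> p)) (derived_rel c E r \<omega>) X"
  shows "canon_set (Suc j) r c E X"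
proof -
  obtain I where I: "I \<subseteq> {1..j}"
    and c': "\<And>p q. p \<in> nsets X j \<Longrightarrow> q \<in> nsets X j \<Longrightarrow> c (insert \<omega> p) = c (insert \<omega> q) \<longleftrightarrow> canonical_eq I p q"
    using canon unfolding canon_set_def by blast
  have const: "derived_rel c E r \<omega> l x = derived_rel c E r \<omega> l y"
    if "l < Suc r" "x \<in> nsets X (Suc j)" "y \<in> nsets X (Suc j)" for l x y
    using canon that unfolding canon_set_def by blast
  have up: "x \<in> nsets A i" if "x \<in> nsets X i" for x i using that X by (auto simp: nsets_def)
  \<comment> \<open>By the threshold, \<open>E\<close> does not see the last element, which may
    therefore be replaced by \<open>\<omega>\<close>; there the derived relation is
    constant.\<close>
  have E_omega: "\<exists>x'\<in>nsets X (Suc j). E l x = E l (insert \<omega> x')" if l: "l < r" and x: "x \<in> nsets X (Suc (Suc j))" for l x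
  proof -
    obtain z p where zp: "x = insert z p" "z \<in> X" "p \<in> nsets X (Suc j)" "below p z" by (rule nsets_Suc_maxE[OF x])
    obtain b y where yb: "p = insert b y" "b \<in> X" "y \<in> nsets X j" "below y b" by (rule nsets_Suc_maxE[OF zp(3)])
    obtain \<theta> where th: "threshold_at E A (insert \<omega> A) l y \<theta>" using thr l up[OF yb(3)] by blast
    have "b \<in> A" "z \<in> A" "b < z" "b < \<omega>" using X \<omega> zp yb by auto
    hence "E l (insert z (insert b y)) = (b < \<theta>)" "E l (insert \<omega> (insert b y)) = (b < \<theta>)"
      using th yb(4) unfolding threshold_at_def by blast+
    thus ?thesis using zp yb by auto
  qed
  have "E l x = E l y" if l: "l < r" and xy: "x \<in> nsets X (Suc (Suc j))" "y \<in> nsets X (Suc (Suc j))" for l x y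
  proof -
    obtain x' y' where "x' \<in> nsets X (Suc j)" "y' \<in> nsets X (Suc j)" "E l x = E l (insert \<omega> x')" "E l y = E l (insert \<omega> y')"
      using E_omega[OF l xy(1)] E_omega[OF l xy(2)] by blast
    thus ?thesis using const[of l x' y'] l by (simp add: derived_rel_def)
  qed
  moreover have "\<exists>I'\<subseteq>{1..Suc j}. \<forall>x\<in>nsets X (Suc j). \<forall>y\<in>nsets X (Suc j). c x = c y \<longleftrightarrow> canonical_eq I' x y"
  proof (cases "\<exists>x\<in>nsets X (Suc j). derived_rel c E r \<omega> r x")
    case True
    have "c x = c y \<longleftrightarrow> canonical_eq I x y" if xy: "x \<in> nsets X (Suc j)" "y \<in> nsets X (Suc j)" for x y
    proof -
      obtain z p where zp: "x = insert z p" "z \<in> X" "p \<in> nsets X j" "below p z" by (rule nsets_Suc_maxE[OF xy(1)])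
      obtain z' q where zq: "y = insert z' q" "z' \<in> X" "q \<in> nsets X j" "below q z'" by (rule nsets_Suc_maxE[OF xy(2)])
      have fin: "finite p" "card p = j" "finite q" "card q = j" using zp zq by (auto simp: nsets_def)
      have "derived_rel c E r \<omega> r x" "derived_rel c E r \<omega> r y" using True const xy by blast+
      hence "c x = c (insert \<omega> p)" "c y = c (insert \<omega> q)"
        using derived_rel_last fin zp zq by metis+
      thus ?thesis using c'[OF zp(3) zq(3)] canonical_eq_insert_max(1)[OF I fin(1,2) zp(4) fin(3,4) zq(4)] zp(1) zq(1)
        by simp
    qed
    moreover have "I \<subseteq> {1..Suc j}" using I by auto
    ultimately show ?thesis by blast
  next
    case False
    \<comment> \<open>A coincidence of colours at \<open>z'\<close> would persist at
      \<open>\<omega>\<close>, so extending \<open>q\<close> by \<open>z'\<close> and by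
      \<open>\<omega>\<close> would give the same colour, against the case assumption.\<close>
    have neq: "c (insert z p) \<noteq> c (insert z' q)"
      if "z < z'" "z \<in> X" "z' \<in> X" "p \<in> nsets X j" "q \<in> nsets X j" "below p z" "below q z'" for z z' p q
    proof
      assume eq: "c (insert z p) = c (insert z' q)"
      have q: "finite q" "q \<subseteq> A" "p \<subseteq> A" using up[OF that(5)] up[OF that(4)] by (auto simp: nsets_def)
      have "insert z p \<in> nsets A (Suc j)" using insert_in_nsets[OF up[OF that(4)]] that X by blast
      moreover have "below (q \<union> insert z p) z'" using that by (auto intro: less_trans)
      moreover have "below (q \<union> insert z p) \<omega>" "z' \<in> A" using that X \<omega> q by auto
      ultimately have "(c (insert z' q) = c (insert z p)) = (c (insert \<omega> q) = c (insert z p))"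
        by (intro end_homogeneousD2[OF eh up[OF that(5)]]) auto
      hence "c (insert z' q) = c (insert \<omega> q)" using eq by simp
      hence "derived_rel c E r \<omega> r (insert z' q)" using derived_rel_last[OF q(1) that(7)] by metis
      thus False using False insert_in_nsets[OF that(5,3,7)] by blast
    qed
    have "c x = c y \<longleftrightarrow> canonical_eq (insert (Suc j) I) x y" if xy: "x \<in> nsets X (Suc j)" "y \<in> nsets X (Suc j)" for x y
    proof -
      obtain z p where zp: "x = insert z p" "z \<in> X" "p \<in> nsets X j" "below p z" by (rule nsets_Suc_maxE[OF xy(1)])
      obtain z' q where zq: "y = insert z' q" "z' \<in> X" "q \<in> nsets X j" "below q z'" by (rule nsets_Suc_maxE[OF xy(2)])
      have fin: "finite p" "card p = j" "finite q" "card q = j" using zp zq by (auto simp: nsets_def)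
      have "c x = c y \<longleftrightarrow> z = z' \<and> canonical_eq I p q"
      proof (cases "z = z'")
        case True
        \<comment> \<open>A common last element can be moved to \<open>\<omega>\<close>, where the
          induced colouring of \<open>j\<close>-sets is canonical.\<close>
        have "p \<subseteq> A" "q \<subseteq> A" using up[OF zp(3)] up[OF zq(3)] by (auto simp: nsets_def)
        hence "(c (insert z p) = c (insert z q)) = (c (insert \<omega> p) = c (insert \<omega> q))"
          using zp zq True X \<omega> by (intro end_homogeneousD1[OF eh up[OF zp(3)] up[OF zq(3)]]) auto
        thus ?thesis using c'[OF zp(3) zq(3)] True zp(1) zq(1) by simp
      next
        case False
        hence "z < z' \<or> z' < z" by linarith
        hence "c x \<noteq> c y"
          using neq[OF _ zp(2) zq(2) zp(3) zq(3) zp(4) zq(4)] neq[OF _ zq(2) zp(2) zq(3) zp(3) zq(4) zp(4)] zp(1) zq(1)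
          by metis
        thus ?thesis using False by simp
      qed
      thus ?thesis using canonical_eq_insert_max(2)[OF I fin(1,2) zp(4) fin(3,4) zq(4)] zp(1) zq(1) by simp
    qed
    moreover have "insert (Suc j) I \<subseteq> {1..Suc j}" using I by auto
    ultimately show ?thesis by blast
  qed
  ultimately show ?thesis unfolding canon_set_def by blast
qed

section \<open>Uniformity one\<close>

text \<open>The relations are made constant first, on \<open>n * n\<close> points, so that the
  colouring of single points can then be made constant (\<open>I\<close> empty) or injective
  (\<open>I = {1}\<close>).\<close>

lemma canon_set_base:
  fixes c :: "nat set \<Rightarrow> 'c"
  assumes "finite S" and mono: "last_mono 1 r E S" and "(2 ^ r * (n * n)) ^ Suc r \<le> card S"
  shows "\<exists>X\<subseteq>S. card X = n \<and> canon_set 1 r c E X"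
proof -
  define G where "G l a b = E l (insert b {a})" for l a b
  have G: "G l a d" if "l < r" "a \<in> S" "b \<in> S" "d \<in> S" "a < b" "b < d" "G l a b" for l a b d
  proof -
    have "{a} \<in> nsets S 1" using that by (simp add: nsets_def)
    thus ?thesis using mono that unfolding last_mono_def G_def by blast
  qed
  have "\<exists>Y L. Y \<subseteq> S \<and> card Y = n * n \<and> (\<forall>l<r. \<forall>a\<in>Y. \<forall>b\<in>Y. a < b \<longrightarrow> G l a b = (l \<in> L))"
    using G by (rule const_relations_on_pairs[OF assms(1,3)])
  then obtain Y L where Y: "Y \<subseteq> S" "card Y = n * n" and L: "\<forall>l<r. \<forall>a\<in>Y. \<forall>b\<in>Y. a < b \<longrightarrow> G l a b = (l \<in> L)"
    by (elim exE conjE)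
  have finY: "finite Y" using Y(1) assms(1) finite_subset by blast
  obtain X where X: "X \<subseteq> Y" "card X = n"
    and c: "(\<forall>x\<in>X. \<forall>y\<in>X. c {x} = c {y}) \<or> inj_on (\<lambda>x. c {x}) X"
    using const_or_injective[OF finY, of n "\<lambda>x. c {x}"] Y(2) by auto
  have pair: "E l x = (l \<in> L)" if l: "l < r" and x: "x \<in> nsets X (Suc 1)" for l x
  proof -
    obtain b p where bp: "x = insert b p" "b \<in> X" "p \<in> nsets X 1" "below p b" by (rule nsets_Suc_maxE[OF x])
    obtain a where "p = {a}" using bp(3) by (auto simp: nsets_def card_1_singleton_iff)
    with bp L l X(1) show ?thesis by (auto simp: G_def nsets_def)
  qed
  have sing: "\<exists>a\<in>X. x = {a}" if "x \<in> nsets X 1" for x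
    using that by (auto simp: nsets_def card_1_singleton_iff)
  have least: "nth_least {a} 1 = a" for a by (simp add: nth_least_def)
  have "\<exists>I\<subseteq>{1..1}. \<forall>x\<in>nsets X 1. \<forall>y\<in>nsets X 1. c x = c y \<longleftrightarrow> canonical_eq I x y"
    using c
  proof
    assume "\<forall>x\<in>X. \<forall>y\<in>X. c {x} = c {y}"
    hence "\<forall>x\<in>nsets X 1. \<forall>y\<in>nsets X 1. c x = c y \<longleftrightarrow> canonical_eq {} x y"
      using sing unfolding canonical_eq_def by blast
    thus ?thesis by (intro exI[of _ "{}"]) simp
  next
    assume inj: "inj_on (\<lambda>x. c {x}) X"
    have "c x = c y \<longleftrightarrow> canonical_eq {1} x y" if xy: "x \<in> nsets X 1" "y \<in> nsets X 1" for x y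
    proof -
      obtain a b where "a \<in> X" "x = {a}" "b \<in> X" "y = {b}" using sing[OF xy(1)] sing[OF xy(2)] by blast
      thus ?thesis using least inj by (auto simp: canonical_eq_def dest: inj_onD)
    qed
    thus ?thesis by (intro exI[of _ "{1}"]) simp
  qed
  moreover have "\<forall>l<r. \<forall>x\<in>nsets X (Suc 1). \<forall>y\<in>nsets X (Suc 1). E l x = E l y"
    using pair by blast
  ultimately have "canon_set 1 r c E X" unfolding canon_set_def by (rule conjI)
  moreover have "X \<subseteq> S" using X(1) Y(1) by (rule subset_trans)
  ultimately show ?thesis using X(2) by (intro exI[of _ X]) simp
qed

section \<open>Tower bounds\<close>

lemma tower_mono: "x \<le> y \<Longrightarrow> tower i x \<le> tower i y"
  by (induction i) auto

lemma tower_ge_1: "1 \<le> x \<Longrightarrow> 1 \<le> tower i x"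
  by (induction i) (auto intro: ge_one_powr_ge_zero)

lemma Suc_le_two_power: "Suc x \<le> 2 ^ x"
  by (induction x) auto

lemma one_le_mult_power:
  assumes "1 \<le> C" "1 \<le> n"
  shows "1 \<le> real C * real n ^ e"
proof -
  have "1 \<le> C * n ^ e" using assms by (simp add: Suc_le_eq)
  thus ?thesis by (metis of_nat_1 of_nat_le_iff of_nat_mult of_nat_power)
qed

lemma nat_mult_powr_le:
  fixes D :: nat and t :: real
  assumes "D \<ge> 1" "t \<ge> 1"
  shows "real D * 2 powr t \<le> 2 powr (real D * t)"
proof -
  have "D \<le> 2 ^ (D - 1)" using assms(1) Suc_le_two_power[of "D - 1"] by simp
  hence "real D \<le> 2 ^ (D - 1)" by (metis of_nat_le_iff of_nat_numeral of_nat_power)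
  also have "\<dots> = 2 powr (real (D - 1))" by (simp add: powr_realpow)
  also have "\<dots> = 2 powr (real D - 1)" using assms(1) by (simp add: of_nat_diff)
  also have "\<dots> \<le> 2 powr ((real D - 1) * t)"
    using assms mult_left_mono[of 1 t "real D - 1"] by simp
  finally have "real D * 2 powr t \<le> 2 powr ((real D - 1) * t) * 2 powr t"
    by (rule mult_right_mono) simp
  also have "\<dots> = 2 powr (real D * t)" by (simp add: algebra_simps flip: powr_add)
  finally show ?thesis .
qed

text \<open>A constant factor in front passes through every exponential into the innermost argument,
  where it only changes \<open>C\<close>.\<close>

lemma mult_tower_le:
  assumes "D \<ge> 1" "x \<ge> 1"
  shows "real D * tower i x \<le> tower i (real D * x)"
proof (induction i)
  case (Suc i)
  have "real D * tower (Suc i) x \<le> 2 powr (real D * tower i x)"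
    using nat_mult_powr_le[OF assms(1) tower_ge_1[OF assms(2)]] by simp
  also have "\<dots> \<le> tower (Suc i) (real D * x)" using Suc.IH by simp
  finally show ?case .
qed simp

text \<open>Both factors of \<open>step_loss\<close> are two to a power of order
  \<open>m ^ (2 * J)\<close>, with coefficients \<open>(r + 1)\<^sup>2\<close> and
  \<open>J + 2\<close>; the \<open>m\<close> steps contribute one more factor \<open>m\<close> in
  the exponent.\<close>

lemma step_loss_power_le:
  assumes "m \<ge> 1" "J \<ge> 1"
  shows "step_loss r J m ^ m \<le> 2 ^ (((r + 1)\<^sup>2 + J + 2) * m ^ (2 * J + 1))"
proof -
  define a where "a = Suc (r * m ^ J)"
  have "2 * a \<le> 2 ^ a" using Suc_le_two_power[of "r * m ^ J"] by (simp add: a_def)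
  hence "(2 * a) ^ a \<le> (2 ^ a) ^ a" by (rule power_mono) simp
  also have "\<dots> = 2 ^ (a * a)" by (simp only: power_mult)
  finally have "(2 * a) ^ a \<le> 2 ^ (a * a)" .
  moreover have "a * a \<le> (r + 1)\<^sup>2 * m ^ (2 * J)"
  proof -
    have "1 \<le> m ^ J" using assms(1) by simp
    hence "a \<le> (r + 1) * m ^ J" by (simp add: a_def)
    hence "a\<^sup>2 \<le> ((r + 1) * m ^ J)\<^sup>2" by (rule power_mono) simp
    also have "\<dots> = (r + 1)\<^sup>2 * m ^ (2 * J)" by (simp only: power_mult_distrib flip: power_mult) (simp add: mult.commute)
    finally show ?thesis by (simp add: power2_eq_square)
  qed
  ultimately have 1: "(2 * a) ^ a \<le> 2 ^ ((r + 1)\<^sup>2 * m ^ (2 * J))"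
    by (meson le_trans one_le_numeral power_increasing)
  have "m \<le> 2 ^ m" using Suc_le_two_power[of m] by simp
  hence "m ^ Suc J \<le> (2 ^ m) ^ Suc J" by (rule power_mono) simp
  hence "2 * m ^ Suc J \<le> 2 * 2 ^ (m * Suc J)" by (simp only: power_mult mult_le_mono2)
  hence "2 * m ^ Suc J \<le> 2 ^ (1 + m * Suc J)" by simp
  hence "(2 * m ^ Suc J) ^ m ^ J \<le> (2 ^ (1 + m * Suc J)) ^ m ^ J" by (rule power_mono) simp
  also have "\<dots> = 2 ^ ((1 + m * Suc J) * m ^ J)" by (simp only: power_mult)
  also have "\<dots> \<le> 2 ^ ((J + 2) * m ^ (2 * J))"
  proof (rule power_increasing)
    have "1 + m * Suc J \<le> (J + 2) * m" using assms(1) by simp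
    hence "(1 + m * Suc J) * m ^ J \<le> (J + 2) * m * m ^ J" by (rule mult_le_mono1)
    also have "\<dots> = (J + 2) * m ^ Suc J" by (simp only: power_Suc mult.assoc)
    \<comment> \<open>Here \<open>J \<ge> 1\<close> enters, through
      \<open>Suc J \<le> 2 * J\<close>.\<close>
    also have "\<dots> \<le> (J + 2) * m ^ (2 * J)" using assms by (intro mult_le_mono2 power_increasing) auto
    finally show "(1 + m * Suc J) * m ^ J \<le> (J + 2) * m ^ (2 * J)" .
  qed simp
  finally have 2: "(2 * m ^ Suc J) ^ m ^ J \<le> 2 ^ ((J + 2) * m ^ (2 * J))" .
  have "step_loss r J m \<le> 2 ^ ((r + 1)\<^sup>2 * m ^ (2 * J)) * 2 ^ ((J + 2) * m ^ (2 * J))"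
    unfolding step_loss_def a_def[symmetric] using 1 2 by (rule mult_le_mono)
  also have "\<dots> = 2 ^ (((r + 1)\<^sup>2 + J + 2) * m ^ (2 * J))"
    by (simp only: power_add[symmetric] add_mult_distrib add.assoc)
  finally have "step_loss r J m ^ m \<le> (2 ^ (((r + 1)\<^sup>2 + J + 2) * m ^ (2 * J))) ^ m"
    by (rule power_mono) simp
  also have "\<dots> = 2 ^ (((r + 1)\<^sup>2 + J + 2) * m ^ (2 * J + 1))"
    by (simp only: power_mult[symmetric] power_add power_one_right mult.assoc)
  finally show ?thesis .
qed

section \<open>The exponent of \<open>n\<close> and the induction on the uniformity\<close>

text \<open>For uniformity \<open>j + 1\<close> with \<open>r\<close> relations. A step down turns
  \<open>(Suc j, r)\<close> into \<open>(j, Suc r)\<close> and so preserves \<open>r + j\<close>;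
  only the step into \<open>j = 0\<close> changes the exponent, by a factor of three. Starting from
  \<open>r = 0\<close> and \<open>j = k - 1\<close> this is \<open>6 * k\<close>.\<close>

definition er_exponent :: "nat \<Rightarrow> nat \<Rightarrow> nat" where
  "er_exponent j r = (if j = 0 then 2 * (r + 1) else 6 * (r + j + 1))"

text \<open>For \<open>j = 0\<close> the number \<open>m\<close> is polynomial in \<open>n\<close>
  and is raised to the power \<open>3\<close>, which triples the exponent. For larger
  \<open>j\<close> it is at most a constant times a power of two, so raising it to a fixed power
  only multiplies the exponent of that power by a constant, which goes into \<open>C\<close>. The
  factor \<open>2\<close> allows for rounding \<open>m\<close> up.\<close>

lemma tower_step:
  fixes C0 D :: nat
  assumes "C0 \<ge> 1" "D \<ge> 1"
  shows "\<exists>C\<ge>1. \<forall>n\<ge>1. \<forall>m. real m \<le> 2 * tower j (real C0 * real n ^ er_exponent j (Suc r)) \<longrightarrow>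
    real (D * m ^ (2 * Suc j + 1)) \<le> tower j (real (C::nat) * real n ^ er_exponent (Suc j) r)"
proof (cases j)
  case 0
  show ?thesis
  proof (intro exI[of _ "8 * D * C0 ^ 3"] conjI allI impI)
    show "1 \<le> 8 * D * C0 ^ 3" using assms by (simp add: Suc_le_eq)
    fix n m :: nat
    assume "real m \<le> 2 * tower j (real C0 * real n ^ er_exponent j (Suc r))"
    hence "real m \<le> real (2 * (C0 * n ^ (2 * (r + 2))))"
      using 0 by (simp add: er_exponent_def)
    hence "m \<le> 2 * (C0 * n ^ (2 * (r + 2)))" by (simp only: of_nat_le_iff)
    hence "m ^ 3 \<le> (2 * (C0 * n ^ (2 * (r + 2)))) ^ 3" by (rule power_mono) simp
    also have "\<dots> = 8 * C0 ^ 3 * (n ^ (2 * (r + 2))) ^ 3"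
      by (simp only: power_mult_distrib) simp
    also have "(n ^ (2 * (r + 2))) ^ 3 = n ^ (6 * (r + 2))"
    proof -
      have "2 * (r + 2) * 3 = 6 * (r + 2)" by simp
      thus ?thesis by (metis power_mult)
    qed
    finally have "D * m ^ 3 \<le> D * (8 * C0 ^ 3 * n ^ (6 * (r + 2)))" by (rule mult_le_mono2)
    hence "real (D * m ^ 3) \<le> real (D * (8 * C0 ^ 3 * n ^ (6 * (r + 2))))" by (simp only: of_nat_le_iff)
    thus "real (D * m ^ (2 * Suc j + 1)) \<le> tower j (real (8 * D * C0 ^ 3) * real n ^ er_exponent (Suc j) r)"
      using 0 by (simp add: er_exponent_def mult_ac)
  qed
next
  case (Suc j')
  define q where "q = 2 * Suc j + 1"
  have e: "er_exponent j (Suc r) = er_exponent (Suc j) r" using Suc by (simp add: er_exponent_def)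
  \<comment> \<open>In the witness, \<open>D\<close> comes from bounding the coefficient by
    \<open>2 powr D\<close>, and \<open>2 * q\<close> from \<open>1 + U \<le> 2 * U\<close>.\<close>
  show ?thesis unfolding e
  proof (intro exI[of _ "(D + 2 * q) * C0"] conjI allI impI)
    show "1 \<le> (D + 2 * q) * C0" using assms by (simp add: Suc_le_eq)
    fix n m :: nat
    assume n: "1 \<le> n"
    define x where "x = real C0 * real n ^ er_exponent (Suc j) r"
    assume m: "real m \<le> 2 * tower j (real C0 * real n ^ er_exponent (Suc j) r)"
    have x: "x \<ge> 1" unfolding x_def using assms(1) n by (rule one_le_mult_power)
    define U where "U = tower j' x"
    have U: "U \<ge> 1" unfolding U_def by (rule tower_ge_1[OF x])
    have "D \<le> 2 ^ D" by (simp add: less_imp_le)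
    hence D: "real D \<le> 2 powr D" by (simp add: powr_realpow)
    have "real m \<le> 2 powr (1 + U)" using m unfolding x_def[symmetric] by (simp add: Suc U_def powr_add)
    hence "real m ^ q \<le> (2 powr (1 + U)) ^ q" by (rule power_mono) simp
    also have "\<dots> = 2 powr (real q * (1 + U))" by (simp add: powr_power mult.commute)
    finally have "real D * real m ^ q \<le> 2 powr D * 2 powr (real q * (1 + U))"
      using D by (intro mult_mono) auto
    also have "\<dots> = 2 powr (real D + real q * (1 + U))" by (simp add: powr_add)
    also have "\<dots> \<le> 2 powr (real (D + 2 * q) * U)"
    proof -
      have "real D * 1 \<le> real D * U" "real q * (1 + U) \<le> real q * (2 * U)"
        using U by (intro mult_left_mono; simp)+
      thus ?thesis by (simp add: algebra_simps)
    qed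
    also have "\<dots> \<le> 2 powr (tower j' (real (D + 2 * q) * x))"
      using mult_tower_le[of "D + 2 * q" x j'] assms(2) x by (simp add: U_def)
    finally have "real D * real m ^ q \<le> tower j (real (D + 2 * q) * x)"
      by (simp only: Suc tower.simps)
    thus "real (D * m ^ (2 * Suc j + 1)) \<le> tower j (real ((D + 2 * q) * C0) * real n ^ er_exponent (Suc j) r)"
      by (simp only: x_def q_def of_nat_mult of_nat_power mult.assoc)
  qed
qed

text \<open>The number \<open>r\<close> of relations is general because each step down adds one,
  while \<open>C\<close> may depend on \<open>j\<close> and \<open>r\<close>. One step costs one
  exponential: \<open>m\<close> points survive from a set of size two to a polynomial in
  \<open>m\<close>.\<close>

lemma canon_set_exists:
  "\<exists>C\<ge>1. \<forall>n\<ge>1. \<forall>S (c :: nat set \<Rightarrow> 'c) E. finite S \<longrightarrow> last_mono (Suc j) r E S \<longrightarrow>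
     tower j (real (C::nat) * real n ^ er_exponent j r) \<le> real (card S) \<longrightarrow>
     (\<exists>X\<subseteq>S. card X = n \<and> canon_set (Suc j) r c E X)"
proof (induction j arbitrary: r)
  case 0
  show ?case
  proof (intro exI[of _ "(2 ^ r) ^ Suc r"] conjI allI impI)
    fix n S and c :: "nat set \<Rightarrow> 'c" and E
    assume S: "finite S" "last_mono (Suc 0) r E S"
      and "tower 0 (real ((2 ^ r) ^ Suc r) * real n ^ er_exponent 0 r) \<le> real (card S)"
    hence "real ((2 ^ r) ^ Suc r * n ^ (2 * Suc r)) \<le> real (card S)"
      by (simp add: er_exponent_def)
    hence "(2 ^ r) ^ Suc r * n ^ (2 * Suc r) \<le> card S" by (simp only: of_nat_le_iff)
    hence "(2 ^ r * (n * n)) ^ Suc r \<le> card S"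
      by (simp only: power_mult_distrib power_mult power2_eq_square)
    thus "\<exists>X\<subseteq>S. card X = n \<and> canon_set (Suc 0) r c E X"
      using canon_set_base[of S r E n c] S by simp
  qed simp
next
  case (Suc j)
  obtain C0 where C0: "C0 \<ge> 1"
    and IH: "\<forall>n\<ge>1. \<forall>S (c :: nat set \<Rightarrow> 'c) E. finite S \<longrightarrow> last_mono (Suc j) (Suc r) E S \<longrightarrow>
     tower j (real C0 * real n ^ er_exponent j (Suc r)) \<le> real (card S) \<longrightarrow>
     (\<exists>X\<subseteq>S. card X = n \<and> canon_set (Suc j) (Suc r) c E X)"
    using Suc.IH[of "Suc r"] by (elim exE conjE)
  define D where "D = (r + 1)\<^sup>2 + Suc j + 2"
  have "D \<ge> 1" by (simp add: D_def)
  from tower_step[OF C0 this, of j r]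
  obtain C where C: "C \<ge> 1" "\<forall>n\<ge>1. \<forall>m. real m \<le> 2 * tower j (real C0 * real n ^ er_exponent j (Suc r)) \<longrightarrow>
    real (D * m ^ (2 * Suc j + 1)) \<le> tower j (real (C::nat) * real n ^ er_exponent (Suc j) r)"
    by (elim exE conjE)
  show ?case
  proof (intro exI[of _ C] conjI allI impI)
    fix n :: nat and S and c :: "nat set \<Rightarrow> 'c" and E
    assume n: "n \<ge> 1" and S: "finite S" "last_mono (Suc (Suc j)) r E S"
      and size: "tower (Suc j) (real C * real n ^ er_exponent (Suc j) r) \<le> real (card S)"
    define T where "T = tower j (real C0 * real n ^ er_exponent j (Suc r))"
    have T: "T \<ge> 1" unfolding T_def
      by (intro tower_ge_1 one_le_mult_power C0 n)
    \<comment> \<open>The size that the induction hypothesis needs, rounded up; as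
      \<open>T \<ge> 1\<close>, this is at most \<open>2 * T\<close>.\<close>
    define m where "m = nat \<lceil>T\<rceil>"
    have m: "T \<le> real m" "real m \<le> 2 * T" "m \<ge> 1" using T unfolding m_def by linarith+
    have "real (2 ^ x) = 2 powr real x" for x :: nat by (simp add: powr_realpow)
    hence "real (2 ^ (D * m ^ (2 * Suc j + 1))) = 2 powr real (D * m ^ (2 * Suc j + 1))" .
    also have "\<dots> \<le> real (card S)"
      using C(2)[rule_format, OF n m(2)[unfolded T_def]] by (intro order_trans[OF _ size]) simp
    finally have "2 ^ (D * m ^ (2 * Suc j + 1)) \<le> card S" by (simp only: of_nat_le_iff)
    hence "step_loss r (Suc j) m ^ m \<le> card S"
      using step_loss_power_le[OF m(3), of "Suc j" r] unfolding D_def by simp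
    then obtain A \<omega> where A: "A \<subseteq> S" "\<omega> \<in> S" "card A = m" "below A \<omega>"
      and eh: "end_homogeneous c (Suc j) A (insert \<omega> A)"
      and thr: "\<forall>l<r. \<forall>y\<in>nsets A (Suc j). \<exists>\<theta>. threshold_at E A (insert \<omega> A) l y \<theta>"
      using end_homogeneous_subset[OF S, of m c] m(3) by auto
    have finA: "finite A" using A(1) S(1) finite_subset by blast
    have mono: "last_mono (Suc j) (Suc r) (derived_rel c E r \<omega>) A"
      by (rule last_mono_derived[OF A(4) eh thr])
    have "tower j (real C0 * real n ^ er_exponent j (Suc r)) \<le> real (card A)"
      using m(1) A(3) by (simp add: T_def)
    from IH[rule_format, OF n finA mono this, of "\<lambda>p. c (insert \<omega> p)"]
    obtain X where X: "X \<subseteq> A" "card X = n"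
      "canon_set (Suc j) (Suc r) (\<lambda>p. c (insert \<omega> p)) (derived_rel c E r \<omega>) X"
      by (elim exE conjE)
    have "canon_set (Suc (Suc j)) r c E X"
      by (rule canon_set_lift[OF A(4) eh thr X(1,3)])
    thus "\<exists>X\<subseteq>S. card X = n \<and> canon_set (Suc (Suc j)) r c E X"
      using X A(1) by blast
  qed (rule C(1))
qed

theorem mainTheorem3:
  fixes k :: nat
  assumes "k \<ge> 2"
  shows "\<exists>C::real. \<forall>n::nat. n > 0 \<longrightarrow>
           real (ER k n) \<le> tower (k - 1) (C * real n ^ (6 * k))"
proof -
  obtain j where k: "k = Suc j" "j > 0" using assms by (cases k) auto
  have e: "er_exponent j 0 = 6 * k" using k by (simp add: er_exponent_def)
  obtain C :: nat where C: "C \<ge> 1"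
    and ex: "\<forall>n\<ge>1. \<forall>S (c :: nat set \<Rightarrow> nat set set) E. finite S \<longrightarrow> last_mono k 0 E S \<longrightarrow>
     tower j (real C * real n ^ (6 * k)) \<le> real (card S) \<longrightarrow> (\<exists>X\<subseteq>S. card X = n \<and> canon_set k 0 c E X)"
    using canon_set_exists[of j 0] unfolding e k(1)[symmetric] by (elim exE conjE)
  have "real (ER k n) \<le> tower j (real (2 * C) * real n ^ (6 * k))" if n: "n \<ge> 1" for n
  proof -
    define T where "T = tower j (real C * real n ^ (6 * k))"
    have x: "1 \<le> real C * real n ^ (6 * k)" using C n by (rule one_le_mult_power)
    have T: "T \<ge> 1" unfolding T_def by (rule tower_ge_1[OF x])
    have "canonical_ramsey k n N" if N: "N \<ge> nat \<lceil>T\<rceil>" for N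
      unfolding canonical_ramsey_def
    proof (intro allI impI)
      fix R assume R: "equiv (nsets {1..N} k) R"
      have size: "tower j (real C * real n ^ (6 * k)) \<le> real (card {1..N})"
        using N unfolding T_def[symmetric] by simp
      have mono: "last_mono k 0 (\<lambda>_ _. False) {1..N}" by (simp add: last_mono_def)
      \<comment> \<open>Colouring each set by its equivalence class turns \<open>R\<close> into
        equality of colours.\<close>
      from ex[rule_format, OF n finite_atLeastAtMost mono size, of "\<lambda>x. R `` {x}"]
      obtain X where X: "X \<subseteq> {1..N}" "card X = n" "canon_set k 0 (\<lambda>x. R `` {x}) (\<lambda>_ _. False) X"
        by (elim exE conjE)
      then obtain I where I: "I \<subseteq> {1..k}"
        "\<And>x y. x \<in> nsets X k \<Longrightarrow> y \<in> nsets X k \<Longrightarrow> R `` {x} = R `` {y} \<longleftrightarrow> canonical_eq I x y"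
        unfolding canon_set_def by blast
      have "(x, y) \<in> R \<longleftrightarrow> canonical_eq I x y" if "x \<in> nsets X k" "y \<in> nsets X k" for x y
        using I(2)[OF that] eq_equiv_class_iff[OF R, of x y] that nsets_mono[OF X(1), of k] by blast
      thus "\<exists>X I. X \<subseteq> {1..N} \<and> card X = n \<and> I \<subseteq> {1..k} \<and>
           (\<forall>x\<in>nsets X k. \<forall>y\<in>nsets X k. (x, y) \<in> R \<longleftrightarrow> canonical_eq I x y)"
        using X(1,2) I(1) by blast
    qed
    hence "ER k n \<le> nat \<lceil>T\<rceil>" unfolding ER_def by (intro Least_le) blast
    \<comment> \<open>Rounding \<open>T\<close> up costs at most a factor \<open>2\<close>, which
      \<open>mult_tower_le\<close> moves into the constant; hence the witness
      \<open>2 * C\<close>.\<close>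
    hence "real (ER k n) \<le> 2 * T" using T by linarith
    also have "\<dots> \<le> tower j (real 2 * (real C * real n ^ (6 * k)))"
      unfolding T_def using mult_tower_le[of 2 _ j, OF _ x] by simp
    finally show ?thesis by (simp add: mult.assoc)
  qed
  then show ?thesis
    using k by (intro exI[of _ "real (2 * C)"]) (simp add: Suc_le_eq)
qed

end
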